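(* Let $f(x), g(x) \in \mathbb{F}_q[x]$ be nonconstant polynomials such that $f(x)-g(y)\notin \mathbb{F}_q[x^p,y^p]$. Suppose that the irreducible components of the curve $\mathcal{F}: f(x)=g(y)$ are defined over $\mathbb{F}_q$. Then the irreducible components of $\mathcal{F}$ are all $q$-Frobenius nonclassical if and only if there exist a monic polynomial $T\in \mathbb{F}_q[x]$ and a constant $\theta \in \mathbb{F}_q^*$ such that $$T(f(x))=\theta(x^q-x)f'(x) \quad\text{and}\quad T(g(y))=\theta(y^q-y)g'(y).$$
   Context: $p$ is a prime and $q$ is a power of $p$; $\overline{\mathbb{F}_q}$ is the algebraic closure of $\mathbb{F}_q$; $f'$ denotes the formal derivative. The irreducible components of a plane curve $G(x,y)=0$ are the curves $G_i=0$, where the $G_i$ are the irreducible factors of $G$ in $\overline{\mathbb{F}_q}[x,y]$; a component is defined over $\mathbb{F}_q$ if, up to a nonzero constant, $G_i\in\mathbb{F}_q[x,y]$. An (absolutely) irreducible plane curve $F(x,y)=0$ with $F\in\mathbb{F}_q[x,y]$ is called $q$-Frobenius nonclassical if $F$ divides $(x^q-x)\frac{\partial F}{\partial x}+(y^q-y)\frac{\partial F}{\partial y}$. *)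

theory Defs
  imports
    "HOL-Computational_Algebra.Computational_Algebra"
    "HOL-Algebra.Algebraic_Closure_Type"
begin

(* A bivariate polynomial ring K[x,y] is represented as K[x][y], i.e. by the type 'k poly poly:
   the outer variable is y and the coefficients are polynomials in x.
   HOL-Algebra also has constants called irreducible, prime and monom, hence the qualified names. *)

definition in_x :: "'k::comm_ring_1 poly \<Rightarrow> 'k poly poly" where
  "in_x f = [:f:]"

definition in_y :: "'k::comm_ring_1 poly \<Rightarrow> 'k poly poly" where
  "in_y g = map_poly (\<lambda>c. [:c:]) g"

definition partial_x :: "'k::idom poly poly \<Rightarrow> 'k poly poly" where
  "partial_x F = map_poly pderiv F"

definition partial_y :: "'k::idom poly poly \<Rightarrow> 'k poly poly" where
  "partial_y F = pderiv F"

(* x^q - x as a univariate polynomial *)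
definition frob_poly :: "nat \<Rightarrow> 'k::comm_ring_1 poly" where
  "frob_poly q = Polynomial.monom 1 q - Polynomial.monom 1 1"

(* The subring K[x^p, y^p] of K[x,y]: the image of the substitution H(x,y) |-> H(x^p, y^p).
   The inner pcompose substitutes x^p for x in each coefficient, the outer one y^p for y. *)
definition polys_in_powers :: "nat \<Rightarrow> 'k::comm_ring_1 poly poly set" where
  "polys_in_powers p =
     range (\<lambda>H. pcompose (map_poly (\<lambda>c. pcompose c (Polynomial.monom 1 p)) H)
                         (Polynomial.monom 1 p))"

definition to_closure :: "'a::field poly poly \<Rightarrow> 'a alg_closure poly poly" where
  "to_closure F = map_poly (map_poly to_ac) F"

definition absolutely_irreducible :: "'a::field poly poly \<Rightarrow> bool" where
  "absolutely_irreducible F \<longleftrightarrow> Factorial_Ring.irreducible (to_closure F)"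

(* Components of the curve F = 0 over the algebraic closure. A component is given by any of its
   equations G, so that proportional G describe the same component. *)
definition irreducible_component :: "'a::field poly poly \<Rightarrow> 'a alg_closure poly poly \<Rightarrow> bool" where
  "irreducible_component F G \<longleftrightarrow> Factorial_Ring.irreducible G \<and> G dvd to_closure F"

(* H has coefficients in the ground field and is a nonzero constant multiple of G. *)
definition ground_equation :: "'a::field poly poly \<Rightarrow> 'a alg_closure poly poly \<Rightarrow> bool" where
  "ground_equation H G \<longleftrightarrow> (\<exists>c. c \<noteq> 0 \<and> to_closure H = smult [:c:] G)"

definition defined_over_ground :: "'a::field alg_closure poly poly \<Rightarrow> bool" where
  "defined_over_ground G \<longleftrightarrow> (\<exists>H :: 'a poly poly. ground_equation H G)"

definition frobenius_nonclassical :: "nat \<Rightarrow> 'a::field poly poly \<Rightarrow> bool" where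
  "frobenius_nonclassical q F \<longleftrightarrow> absolutely_irreducible F \<and>
     F dvd in_x (frob_poly q) * partial_x F + in_y (frob_poly q) * partial_y F"

(* The notion for a component, which is given by an equation over the closure; it does not depend
   on the choice of the equation H over the ground field, which is unique up to a constant. *)
definition component_frobenius_nonclassical ::
    "nat \<Rightarrow> 'a::field alg_closure poly poly \<Rightarrow> bool" where
  "component_frobenius_nonclassical q G \<longleftrightarrow>
     (\<exists>H :: 'a poly poly. ground_equation H G \<and> frobenius_nonclassical q H)"

end

theory Submission
  imports Defs
begin

text \<open>Let \<open>D = (x\<^sup>q - x) \<partial>/\<partial>x + (y\<^sup>q - y) \<partial>/\<partial>y\<close> and \<open>F = f(x) - g(y)\<close>. By the Leibniz rule, if every
  irreducible factor \<open>G\<close> of \<open>F\<close> divides \<open>D G\<close>, then \<open>F\<close> divides \<open>D F\<close>; the converse holds as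
  soon as \<open>F\<close> is squarefree, which follows from \<open>f' \<noteq> 0\<close>. Now \<open>D F = A(x) - B(y)\<close> with
  \<open>A = (x\<^sup>q - x) f'\<close> and \<open>B = (y\<^sup>q - y) g'\<close>. Modulo \<open>F\<close> the ring \<open>K[x,y]\<close> is free over \<open>K[t]\<close>,
  where \<open>t = f(x) = g(y)\<close>, with basis the monomials \<open>x\<^sup>iy\<^sup>j\<close>, \<open>i < deg f\<close>, \<open>j < deg g\<close>. Hence
  \<open>F\<close> divides \<open>A(x) - B(y)\<close> iff \<open>A = T(f)\<close> and \<open>B = T(g)\<close> for some \<open>T \<in> K[t]\<close>, and normalising
  the leading coefficient of \<open>T\<close> gives \<open>\<theta>\<close>.\<close>

section \<open>Base change of coefficients to the algebraic closure\<close>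

lemma map_poly_add:
  assumes "h 0 = 0" and "\<And>a b. h (a + b) = h a + h b"
  shows "map_poly h (P + Q) = map_poly h P + map_poly h Q"
  by (intro poly_eqI) (simp add: coeff_map_poly assms)

lemma map_poly_diff:
  fixes h :: "'a::ab_group_add \<Rightarrow> 'b::ab_group_add"
  assumes "h 0 = 0" and "\<And>a b. h (a - b) = h a - h b"
  shows "map_poly h (P - Q) = map_poly h P - map_poly h Q"
  by (intro poly_eqI) (simp add: coeff_map_poly assms)

lemma map_poly_mult:
  fixes h :: "'a::comm_semiring_0 \<Rightarrow> 'b::comm_semiring_0"
  assumes h: "h 0 = 0" "\<And>a b. h (a + b) = h a + h b" "\<And>a b. h (a * b) = h a * h b"
  shows "map_poly h (P * Q) = map_poly h P * map_poly h Q"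
proof (intro poly_eqI)
  fix n
  have h_sum: "h (sum u A) = (\<Sum>i\<in>A. h (u i))" if "finite A" for u and A :: "nat set"
    using that by (induction A rule: finite_induct) (simp_all add: h)
  show "coeff (map_poly h (P * Q)) n = coeff (map_poly h P * map_poly h Q) n"
    by (simp add: coeff_map_poly coeff_mult h h_sum)
qed

lemma map_poly_to_ac_add: "map_poly to_ac (P + Q) = map_poly to_ac P + map_poly to_ac Q"
  by (simp add: map_poly_add)

lemma map_poly_to_ac_diff: "map_poly to_ac (P - Q) = map_poly to_ac P - map_poly to_ac Q"
  by (simp add: map_poly_diff)

lemma map_poly_to_ac_mult: "map_poly to_ac (P * Q) = map_poly to_ac P * map_poly to_ac Q"
  by (simp add: map_poly_mult)

lemma map_poly_to_ac_eq_0_iff: "map_poly to_ac P = 0 \<longleftrightarrow> P = 0"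
  by (simp add: poly_eq_iff coeff_map_poly)

lemma is_unit_map_poly_to_ac_iff: "is_unit (map_poly to_ac P) \<longleftrightarrow> is_unit P"
  using is_unit_iff_degree[of P] is_unit_iff_degree[of "map_poly to_ac P"]
  by (cases "P = 0") (simp_all add: degree_map_poly map_poly_to_ac_eq_0_iff)

lemma map_poly_to_ac_pderiv: "map_poly to_ac (pderiv P) = pderiv (map_poly to_ac P)"
  by (intro poly_eqI) (simp add: coeff_map_poly coeff_pderiv del: of_nat_Suc)

lemma to_closure_add: "to_closure (F + G) = to_closure F + to_closure G"
  by (simp add: to_closure_def map_poly_add map_poly_to_ac_add)

lemma to_closure_diff: "to_closure (F - G) = to_closure F - to_closure G"
  by (simp add: to_closure_def map_poly_diff map_poly_to_ac_diff)

lemma to_closure_mult: "to_closure (F * G) = to_closure F * to_closure G"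
  by (simp add: to_closure_def map_poly_mult map_poly_to_ac_add map_poly_to_ac_mult)

lemma to_closure_eq_0_iff: "to_closure F = 0 \<longleftrightarrow> F = 0"
  unfolding to_closure_def by (rule map_poly_eq_0_iff) (simp_all add: map_poly_to_ac_eq_0_iff)

lemma to_closure_dvd: "F dvd G \<Longrightarrow> to_closure F dvd to_closure G"
  by (auto elim!: dvdE simp: to_closure_mult)

lemma degree_to_closure: "degree (to_closure F) = degree F"
  unfolding to_closure_def by (rule degree_map_poly) (simp add: map_poly_to_ac_eq_0_iff)

lemma lead_coeff_to_closure: "lead_coeff (to_closure F) = map_poly to_ac (lead_coeff F)"
  unfolding degree_to_closure by (simp add: to_closure_def coeff_map_poly)

section \<open>The embeddings of K[x] and K[y] into K[x,y]\<close>

lemma in_x_mult: "in_x (f * g) = in_x f * in_x g"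
  by (simp add: in_x_def)

lemma in_y_add: "in_y (f + g) = in_y f + in_y g"
  by (simp add: in_y_def map_poly_add)

lemma in_y_mult: "in_y (f * g) = in_y f * in_y g"
  by (simp add: in_y_def map_poly_mult)

lemma coeff_in_y: "coeff (in_y g) n = [:coeff g n:]"
  by (simp add: in_y_def coeff_map_poly)

lemma degree_in_y: "degree (in_y g) = degree g"
  unfolding in_y_def by (rule degree_map_poly) simp

lemma in_y_pcompose_monom:
  "pcompose (in_y g) (Polynomial.monom 1 p) = in_y (pcompose g (Polynomial.monom 1 p))"
proof (induction g)
  case 0
  then show ?case by (simp add: in_y_def)
next
  case (pCons c g)
  have 1: "in_y (pCons c g) = pCons [:c:] (in_y g)"
    by (simp add: in_y_def map_poly_pCons)
  have 2: "in_y (Polynomial.monom 1 p :: 'a poly) = Polynomial.monom 1 p"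
    by (simp add: in_y_def map_poly_monom one_pCons)
  have 3: "in_y [:c:] = [:[:c:]:]"
    by (simp add: in_y_def map_poly_pCons)
  show ?case
    by (simp add: 1 pcompose_pCons in_y_add in_y_mult 2 3 pCons.IH)
qed

lemma to_closure_in_x: "to_closure (in_x f) = in_x (map_poly to_ac f)"
  by (simp add: to_closure_def in_x_def map_poly_pCons)

lemma to_closure_in_y: "to_closure (in_y g) = in_y (map_poly to_ac g)"
  by (intro poly_eqI) (simp add: to_closure_def coeff_map_poly coeff_in_y map_poly_pCons)

section \<open>Divisibility by f(x) - g(y)\<close>

lemma degree_separated:
  assumes "degree g > 0"
  shows "degree (in_x f - in_y g) = degree g"
    and "lead_coeff (in_x f - in_y g) = [:- lead_coeff g:]"
proof -
  have "degree (in_x f) < degree (- in_y g)"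
    using assms by (simp add: in_x_def degree_in_y)
  then show d: "degree (in_x f - in_y g) = degree g"
    using degree_add_eq_right[of "in_x f" "- in_y g"] by (simp add: degree_in_y)
  show "lead_coeff (in_x f - in_y g) = [:- lead_coeff g:]"
    using assms unfolding d by (simp add: coeff_in_y in_x_def coeff_pCons split: nat.split)
qed

text \<open>Horner induction on T for the fact that u - v divides T(u) - T(v).\<close>

lemma separated_dvd_pcompose:
  "in_x f - in_y g dvd in_x (pcompose T f) - in_y (pcompose T g)"
proof (induction T)
  case 0
  then show ?case by (simp add: in_x_def in_y_def)
next
  case (pCons c T)
  have "in_x (pcompose (pCons c T) f) - in_y (pcompose (pCons c T) g)
    = in_x f * (in_x (pcompose T f) - in_y (pcompose T g))
      + (in_x f - in_y g) * in_y (pcompose T g)"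
    by (simp add: pcompose_pCons in_y_add in_y_mult algebra_simps)
      (simp add: in_x_def in_y_def map_poly_pCons)
  then show ?case
    using pCons.IH by simp
qed

text \<open>\<open>W \<in> K[t][y]\<close> collects the digits of the base-\<open>g\<close> expansion of \<open>B\<close>; substituting
  \<open>t = f(x)\<close> gives the remainder of \<open>B(y)\<close> modulo \<open>f(x) - g(y)\<close> with respect to \<open>y\<close>.\<close>

lemma base_expansion:
  fixes f g B :: "'a::field poly"
  assumes "degree g > 0"
  obtains W where "degree W < degree g"
    and "poly (map_poly (\<lambda>T. pcompose T g) W) [:0, 1:] = B"
    and "in_x f - in_y g dvd in_y B - map_poly (\<lambda>T. pcompose T f) W"
proof -
  have const: "map_poly (\<lambda>T. pcompose T h) (in_y b) = in_y b" for h b :: "'a poly"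
    by (intro poly_eqI) (simp add: coeff_map_poly coeff_in_y pcompose_pCons)
  \<comment> \<open>Writing B = g B1 + b turns the digits W of B1 into t W + b. In
    \<open>smult [:0, 1:] W\<close> the polynomial \<open>[:0, 1:]\<close> is t; as an evaluation
    point it is y.\<close>
  have step: "map_poly (\<lambda>T. pcompose T h) (smult [:0, 1:] W + in_y b)
      = smult h (map_poly (\<lambda>T. pcompose T h) W) + in_y b" for h b :: "'a poly" and W
    by (intro poly_eqI)
      (simp add: coeff_map_poly coeff_in_y pcompose_pCons pcompose_add pcompose_mult)
  have eval: "poly (in_y b) [:0, 1:] = b" for b :: "'a poly"
    by (simp add: in_y_def pcompose_altdef[symmetric])
  have "\<exists>W. degree W < degree g \<and> poly (map_poly (\<lambda>T. pcompose T g) W) [:0, 1:] = B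
      \<and> in_x f - in_y g dvd in_y B - map_poly (\<lambda>T. pcompose T f) W"
  proof (induction "degree B" arbitrary: B rule: less_induct)
    case less
    show ?case
    proof (cases "degree B < degree g")
      case True
      then show ?thesis
        by (intro exI[of _ "in_y B"]) (simp add: degree_in_y const eval)
    next
      case False
      define B1 b where "B1 = B div g" and "b = B mod g"
      have B: "B = g * B1 + b"
        by (simp add: B1_def b_def)
      have "degree B1 < degree B"
        using False assms unfolding B1_def by (intro degree_div_less) auto
      then obtain W where W: "degree W < degree g"
          "poly (map_poly (\<lambda>T. pcompose T g) W) [:0, 1:] = B1"
          "in_x f - in_y g dvd in_y B1 - map_poly (\<lambda>T. pcompose T f) W"
        using less by blast
      have "degree b < degree g"
        unfolding b_def using assms degree_mod_less[of g B] by fastforce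
      then have "degree (smult [:0, 1:] W + in_y b) < degree g"
        using W(1) by (intro degree_add_less) (simp_all add: degree_in_y)
      moreover have "in_y B - map_poly (\<lambda>T. pcompose T f) (smult [:0, 1:] W + in_y b)
          = in_x f * (in_y B1 - map_poly (\<lambda>T. pcompose T f) W) - (in_x f - in_y g) * in_y B1"
        unfolding step unfolding B by (simp add: in_y_add in_y_mult algebra_simps in_x_def)
      then have "in_x f - in_y g
          dvd in_y B - map_poly (\<lambda>T. pcompose T f) (smult [:0, 1:] W + in_y b)"
        using W(3) by simp
      moreover have "poly (map_poly (\<lambda>T. pcompose T g) (smult [:0, 1:] W + in_y b)) [:0, 1:] = B"
        unfolding step by (simp add: W(2) eval B)
      ultimately show ?thesis by blast
    qed
  qed
  with that show thesis by blast
qed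

text \<open>The remainder of A(x) - B(y) has y-degree below deg g, so divisibility forces it to
  vanish, even when it is only known over the closure. Its coefficient at y^i for i > 0 is, up to
  sign, W_i(f), and f is nonconstant, so W reduces to its constant digit T.\<close>

lemma separated_dvd_imp_pcompose:
  fixes f g A B :: "'a::field poly"
  assumes "degree f > 0" and g: "degree g > 0"
    and dvd: "to_closure (in_x f - in_y g) dvd to_closure (in_x A - in_y B)"
  obtains T where "pcompose T f = A" and "pcompose T g = B"
proof -
  obtain W where W: "degree W < degree g"
      "poly (map_poly (\<lambda>T. pcompose T g) W) [:0, 1:] = B"
      "in_x f - in_y g dvd in_y B - map_poly (\<lambda>T. pcompose T f) W"
    using base_expansion[OF g] by blast
  define S where "S = map_poly (\<lambda>T. pcompose T f) W"
  have "to_closure (in_x f - in_y g)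
      dvd to_closure (in_x A - in_y B) + to_closure (in_y B - S)"
    using dvd to_closure_dvd[OF W(3)] by (simp add: S_def)
  also have "\<dots> = to_closure (in_x A - S)"
    by (simp flip: to_closure_add)
  finally have dvd': "to_closure (in_x f - in_y g) dvd to_closure (in_x A - S)" .
  have "degree S \<le> degree W"
    unfolding S_def by (rule map_poly_degree_leq)
  then have "degree (in_x A - S) < degree g"
    using W(1) g by (intro degree_diff_less) (simp_all add: in_x_def)
  then have "to_closure (in_x A - S) = 0"
    using dvd_imp_degree_le[OF dvd'] g by (auto simp: degree_to_closure degree_separated)
  then have S: "S = [:A:]"
    by (simp add: to_closure_eq_0_iff in_x_def)
  have "coeff W i = 0" if "i > 0" for i
  proof -
    have "pcompose (coeff W i) f = coeff S i"
      by (simp add: S_def coeff_map_poly)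
    also have "\<dots> = 0"
      using that by (simp add: S coeff_pCons split: nat.split)
    finally show ?thesis
      using \<open>degree f > 0\<close> by (simp add: pcompose_eq_0_iff)
  qed
  then have "degree W = 0"
    by (metis leading_coeff_0_iff degree_0 gr0I)
  then obtain T where T: "W = [:T:]"
    by (rule degree_eq_zeroE)
  have "pcompose T f = A"
    using S by (simp add: S_def T map_poly_pCons)
  moreover have "pcompose T g = B"
    using W(2) by (simp add: T map_poly_pCons)
  ultimately show thesis by (rule that)
qed

section \<open>Vanishing derivatives and the characteristic\<close>

lemma pderiv_eq_0_imp_pcompose_monom:
  fixes f :: "'a::idom poly"
  assumes "pderiv f = 0"
  obtains h where "f = pcompose h (Polynomial.monom 1 CHAR('a))"
proof -
  have "\<exists>h. Polynomial.monom (coeff f i) i = pcompose h (Polynomial.monom 1 CHAR('a))" for i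
  proof (cases "coeff f i = 0")
    case True
    then show ?thesis by (intro exI[of _ 0]) simp
  next
    case False
    \<comment> \<open>This is the coefficient of f' at x^(i-1), so the characteristic divides every
      exponent that occurs in f.\<close>
    have "of_nat i * coeff f i = 0"
    proof (cases i)
      case (Suc j)
      then show ?thesis
        using assms coeff_pderiv[of f j] by simp
    qed simp
    with False have "CHAR('a) dvd i"
      by (simp add: of_nat_eq_0_iff_char_dvd)
    then obtain k where "i = CHAR('a) * k" ..
    then show ?thesis
      by (intro exI[of _ "Polynomial.monom (coeff f i) k"])
        (simp add: pcompose_altdef map_poly_monom poly_monom monom_power smult_monom)
  qed
  then obtain h where h: "\<And>i. Polynomial.monom (coeff f i) i
      = pcompose (h i) (Polynomial.monom 1 CHAR('a))"
    by metis
  have "f = (\<Sum>i\<le>degree f. Polynomial.monom (coeff f i) i)"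
    by (simp add: poly_as_sum_of_monoms)
  also have "\<dots> = pcompose (\<Sum>i\<le>degree f. h i) (Polynomial.monom 1 CHAR('a))"
    by (simp add: h pcompose_sum)
  finally show thesis by (rule that)
qed

text \<open>Used contrapositively: a curve outside K[x^p,y^p] has f' or g' nonzero. The preimage
  under the substitution is h(x) - k(y), where f = h(x^p) and g = k(y^p).\<close>

lemma separated_in_polys_in_powers:
  fixes f g :: "'a::idom poly"
  assumes "pderiv f = 0" and "pderiv g = 0"
  shows "in_x f - in_y g \<in> polys_in_powers CHAR('a)"
proof -
  let ?m = "Polynomial.monom 1 CHAR('a) :: 'a poly"
  obtain h k where h: "f = pcompose h ?m" and k: "g = pcompose k ?m"
    using assms by (metis pderiv_eq_0_imp_pcompose_monom)
  have "map_poly (\<lambda>c. pcompose c ?m) (in_x h - in_y k) = in_x f - in_y k"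
    by (intro poly_eqI)
      (simp add: coeff_map_poly coeff_in_y pcompose_diff in_x_def h coeff_pCons pcompose_pCons
        split: nat.split)
  then have "in_x f - in_y g = pcompose (map_poly (\<lambda>c. pcompose c ?m) (in_x h - in_y k))
      (Polynomial.monom 1 CHAR('a))"
    by (simp add: pcompose_diff in_y_pcompose_monom k in_x_def pcompose_pCons)
  then show ?thesis
    unfolding polys_in_powers_def by blast
qed

lemma CHAR_eq_of_card:
  assumes "Factorial_Ring.prime p" and "card (UNIV :: 'a::{field, finite} set) = p ^ n"
  shows "CHAR('a) = p"
proof -
  have "Factorial_Ring.prime CHAR('a)"
    by (intro prime_CHAR_semidom finite_imp_CHAR_pos) simp
  moreover have "CHAR('a) dvd p ^ n"
  proof -
    \<comment> \<open>Translation by 1 permutes the field; comparing both sums shows that the field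
      order is 0 in the field.\<close>
    have "(\<Sum>x\<in>UNIV. x :: 'a) = (\<Sum>x\<in>UNIV. x + 1)"
      by (rule sum.reindex_bij_witness[of _ "\<lambda>x. x + 1" "\<lambda>x. x - 1"]) simp_all
    then have "(of_nat (card (UNIV :: 'a set)) :: 'a) = 0"
      by (simp add: sum.distrib)
    then show ?thesis
      unfolding assms(2) of_nat_eq_0_iff_char_dvd .
  qed
  ultimately show ?thesis
    using assms(1) prime_dvd_power primes_dvd_imp_eq by blast
qed

section \<open>The Frobenius derivation and its behaviour on factors\<close>

definition frob_derivation :: "nat \<Rightarrow> 'k::idom poly poly \<Rightarrow> 'k poly poly" where
  "frob_derivation q F = in_x (frob_poly q) * partial_x F + in_y (frob_poly q) * partial_y F"

lemma partial_x_mult: "partial_x (F * G) = F * partial_x G + partial_x F * G"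
  \<comment> \<open>The first-order instance of \<open>higher_pderiv_sum\<close> moves
    \<open>pderiv\<close> inside the convolution sum.\<close>
  by (intro poly_eqI)
    (simp add: partial_x_def coeff_map_poly coeff_mult pderiv_mult higher_pderiv_sum[of 1, simplified] sum.distrib,
      simp add: mult.commute)

lemma partial_x_separated: "partial_x (in_x f - in_y g) = in_x (pderiv f)"
  by (intro poly_eqI)
    (simp add: partial_x_def in_x_def coeff_map_poly coeff_in_y pderiv_diff coeff_pCons
      pderiv_pCons split: nat.split)

lemma partial_y_separated: "partial_y (in_x f - in_y g) = - in_y (pderiv g)"
  by (intro poly_eqI)
    (simp add: partial_y_def in_x_def coeff_pderiv coeff_in_y of_nat_poly mult.commute)

lemma frob_derivation_mult:
  "frob_derivation q (F * G) = F * frob_derivation q G + frob_derivation q F * G"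
  by (simp add: frob_derivation_def partial_x_mult partial_y_def pderiv_mult algebra_simps)

lemma frob_derivation_const: "frob_derivation q [:[:c:]:] = 0"
  by (simp add: frob_derivation_def partial_x_def partial_y_def map_poly_pCons pderiv_pCons)

lemma frob_derivation_separated:
  "frob_derivation q (in_x f - in_y g)
    = in_x (frob_poly q * pderiv f) - in_y (frob_poly q * pderiv g)"
  by (simp add: frob_derivation_def partial_x_separated partial_y_separated in_x_mult in_y_mult)

lemma to_closure_frob_derivation:
  "to_closure (frob_derivation q F) = frob_derivation q (to_closure F)"
proof -
  have "map_poly to_ac (frob_poly q) = (frob_poly q :: 'a alg_closure poly)"
    by (simp add: frob_poly_def map_poly_to_ac_diff map_poly_monom)
  moreover have "to_closure (partial_x F) = partial_x (to_closure F)"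
    by (intro poly_eqI)
      (simp add: to_closure_def partial_x_def coeff_map_poly map_poly_to_ac_pderiv)
  moreover have "map_poly to_ac (of_nat n * h) = of_nat n * map_poly to_ac h" for n and h :: "'a poly"
    by (intro poly_eqI) (simp add: coeff_map_poly of_nat_poly)
  then have "to_closure (partial_y F) = partial_y (to_closure F)"
    by (intro poly_eqI)
      (simp add: to_closure_def partial_y_def coeff_map_poly coeff_pderiv del: of_nat_Suc)
  ultimately show ?thesis
    by (simp add: frob_derivation_def to_closure_add to_closure_mult to_closure_in_x
        to_closure_in_y)
qed

text \<open>Constants are killed by the derivation, so rescaling the equation of a component does
  not affect nonclassicality.\<close>

lemma frob_derivation_smult: "frob_derivation q (smult [:c:] G) = smult [:c:] (frob_derivation q G)"
  using frob_derivation_mult[of q "[:[:c:]:]" G] by (simp add: frob_derivation_const)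

text \<open>Induction over the prime factorisation: if a divides d a and x divides d x, then a x
  divides both summands of d (a x).\<close>

lemma dvd_derivation_of_irreducible_factors:
  fixes d :: "'a::factorial_semiring \<Rightarrow> 'a"
  assumes leibniz: "\<And>a b. d (a * b) = a * d b + d a * b"
    and "\<And>a. Factorial_Ring.irreducible a \<Longrightarrow> a dvd x \<Longrightarrow> a dvd d a"
  shows "x dvd d x"
  using assms(2)
proof (induction x rule: prime_divisors_induct)
  case zero
  then show ?case using leibniz[of 0 0] by simp
next
  case (unit x)
  then show ?case using unit_imp_dvd by blast
next
  case (factor a x)
  have "a dvd d a"
    using factor by (auto simp: prime_def prime_elem_imp_irreducible)
  moreover have "x dvd d x"
    using factor by (meson dvd_mult)
  ultimately show ?case
    unfolding leibniz by (simp add: mult_dvd_mono)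
qed

lemma smult_const_dvd_iff:
  fixes c :: "'a::field"
  assumes "c \<noteq> 0"
  shows "smult [:c:] G dvd F \<longleftrightarrow> G dvd F" and "F dvd smult [:c:] G \<longleftrightarrow> F dvd G"
proof -
  have unit: "is_unit [:[:c:]:]"
    using assms by (simp add: is_unit_const_poly_iff dvd_field_iff)
  show "smult [:c:] G dvd F \<longleftrightarrow> G dvd F"
    using mult_unit_dvd_iff'[OF unit, of G F] by simp
  show "F dvd smult [:c:] G \<longleftrightarrow> F dvd G"
    using dvd_mult_unit_iff'[OF unit, of F G] by simp
qed

lemma irreducible_smult_const_iff:
  fixes c :: "'a::field"
  assumes "c \<noteq> 0"
  shows "Factorial_Ring.irreducible (smult [:c:] G) \<longleftrightarrow> Factorial_Ring.irreducible G"
proof -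
  have "is_unit [:[:c:]:]"
    using assms by (simp add: is_unit_const_poly_iff dvd_field_iff)
  then show ?thesis
    using irreducible_mult_unit_left[of "[:[:c:]:]" G] by simp
qed

text \<open>With x = a b, the Leibniz rule gives d x = d a * b modulo a. Multiplicity one means that
  the prime a does not divide b, so a divides d a.\<close>

lemma irreducible_dvd_derivation:
  fixes d :: "'a::{factorial_semiring, idom} \<Rightarrow> 'a"
  assumes leibniz: "\<And>a b. d (a * b) = a * d b + d a * b"
    and a: "Factorial_Ring.irreducible a" "a dvd x" "\<not> a\<^sup>2 dvd x" and "x dvd d x"
  shows "a dvd d a"
proof -
  obtain b where b: "x = a * b" using a(2) ..
  have "a dvd d x"
    using a(2) \<open>x dvd d x\<close> by (rule dvd_trans)
  then have "a dvd d a * b"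
    unfolding b leibniz by (simp add: dvd_add_right_iff)
  moreover have "\<not> a dvd b"
    using a(3) by (auto simp: b power2_eq_square mult_dvd_mono)
  ultimately show ?thesis
    using irreducible_imp_prime_elem[OF a(1)] by (simp add: prime_elem_dvd_mult_iff)
qed

text \<open>Divisibility descends from the closure by division with remainder in \<open>y\<close>, which is possible
  because the leading coefficient is a unit of \<open>K[x]\<close>.\<close>

lemma to_closure_dvd_imp_dvd:
  fixes H N :: "'a::field poly poly"
  assumes unit: "is_unit (lead_coeff H)" and dvd: "to_closure H dvd to_closure N"
  shows "H dvd N"
proof -
  have "H \<noteq> 0" using unit by auto
  \<comment> \<open>K[x] is not a field, so pseudo-division is used; its factor u is a power of the
    leading coefficient, hence a unit that is cancelled at the end.\<close>
  obtain Q R where "pseudo_divmod N H = (Q, R)" by fastforce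
  note div = pseudo_divmod[OF \<open>H \<noteq> 0\<close> this]
  define u where "u = lead_coeff H ^ (Suc (degree N) - degree H)"
  have N: "smult u N = H * Q + R"
    using div(1) by (simp add: u_def)
  have "to_closure H dvd to_closure (smult u N - H * Q)"
  proof -
    have "to_closure (smult u N) = to_closure [:u:] * to_closure N"
      by (simp flip: to_closure_mult)
    then show ?thesis
      using dvd by (simp add: to_closure_diff to_closure_mult)
  qed
  then have "to_closure H dvd to_closure R"
    by (simp add: N)
  then have "R = 0"
    using div(2) dvd_imp_degree_le[of "to_closure H" "to_closure R"]
    by (cases "R = 0") (simp_all add: degree_to_closure to_closure_eq_0_iff)
  then have "H dvd smult u N"
    by (simp add: N)
  moreover have "is_unit u"
    using unit by (simp add: u_def is_unit_power_iff)
  then obtain v where "1 = u * v" ..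
  then have "smult v (smult u N) = N"
    by (simp only: smult_smult mult.commute[of v] smult_1_left flip: \<open>1 = u * v\<close>)
  moreover have "H dvd smult v (smult u N)"
    by (rule dvd_smult) fact
  ultimately show ?thesis
    by simp
qed

text \<open>Differentiating in x shows that a repeated factor G divides f'(x), which is nonzero of
  y-degree 0. So G lies in K[x], and it divides the leading coefficient in y, a nonzero constant;
  this contradicts irreducibility.\<close>

lemma separated_irreducible_factor_squarefree:
  fixes f g :: "'k::alg_closed_field poly"
  assumes "degree g > 0" and "pderiv f \<noteq> 0"
    and G: "Factorial_Ring.irreducible G"
  shows "\<not> G\<^sup>2 dvd in_x f - in_y g"
proof
  assume "G\<^sup>2 dvd in_x f - in_y g"
  then obtain M where M: "in_x f - in_y g = G * (G * M)"
    by (metis dvdE power2_eq_square mult.assoc)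
  have "in_x (pderiv f) = G * partial_x (G * M) + partial_x G * (G * M)"
    by (simp flip: partial_x_separated[of f g] add: M partial_x_mult)
  then have "G dvd in_x (pderiv f)" by simp
  then have "degree G = 0"
    using dvd_imp_degree_le[of G "in_x (pderiv f)"] assms(2) by (simp add: in_x_def)
  then obtain u where u: "G = [:u:]" by (rule degree_eq_zeroE)
  have "\<not> is_unit u" and "u \<noteq> 0"
    using G by (auto simp: u irreducible_def is_unit_const_poly_iff)
  then have "degree u > 0"
    by (simp add: is_unit_iff_degree)
  then obtain a where a: "poly u a = 0"
    using alg_closed_imp_poly_has_root by blast
  define c where "c = lead_coeff (in_x f - in_y g)"
  have "u dvd c"
    unfolding c_def M u by (simp add: lead_coeff_mult)
  moreover have "is_unit c"
    unfolding c_def degree_separated(2)[OF assms(1)] using assms(1)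
    by (auto simp: is_unit_const_poly_iff dvd_field_iff)
  ultimately show False
    using \<open>\<not> is_unit u\<close> dvd_trans by blast
qed

theorem theorem3p4:
  fixes p q n :: nat
    and f g :: "'a::{field, finite} poly"
  assumes "Factorial_Ring.prime p" and "n > 0" and "q = p ^ n" and "card (UNIV :: 'a set) = q"
    and "degree f > 0" and "degree g > 0"
    and "in_x f - in_y g \<notin> polys_in_powers p"
    and "\<And>G. irreducible_component (in_x f - in_y g) G \<Longrightarrow> defined_over_ground G"
  shows "(\<forall>G. irreducible_component (in_x f - in_y g) G \<longrightarrow> component_frobenius_nonclassical q G)
    \<longleftrightarrow> (\<exists>T \<theta>. lead_coeff T = 1 \<and> \<theta> \<noteq> 0 \<and>
           pcompose T f = smult \<theta> (frob_poly q * pderiv f) \<and>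
           pcompose T g = smult \<theta> (frob_poly q * pderiv g))"
    (is "?L \<longleftrightarrow> ?R")
proof
  let ?F = "in_x f - in_y g"
  have "CHAR('a) = p"
    using assms(1,3,4) by (intro CHAR_eq_of_card[of p n]) simp_all
  then have deriv: "pderiv f \<noteq> 0 \<or> pderiv g \<noteq> 0"
    using separated_in_polys_in_powers[of f g] assms(7) by auto
  \<comment> \<open>For q = 1 the polynomial x^q - x would vanish.\<close>
  have "q > 1"
    unfolding assms(3) using assms(1,2) by (intro one_less_power prime_gt_1_nat)
  then have "coeff (frob_poly q :: 'a poly) q = 1"
    by (simp add: frob_poly_def)
  then have frob: "frob_poly q \<noteq> (0 :: 'a poly)"
    by (metis coeff_0 zero_neq_one)
  {
    assume L: ?L
    have "G dvd frob_derivation q G"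
      if G: "Factorial_Ring.irreducible G" "G dvd to_closure ?F" for G
    proof -
      obtain H c where H: "H dvd frob_derivation q H" and c: "c \<noteq> 0" "to_closure H = smult [:c:] G"
        using L G unfolding irreducible_component_def component_frobenius_nonclassical_def
          ground_equation_def frobenius_nonclassical_def frob_derivation_def[symmetric] by blast
      have "smult [:c:] G dvd smult [:c:] (frob_derivation q G)"
        using to_closure_dvd[OF H] c by (simp add: to_closure_frob_derivation frob_derivation_smult)
      then show ?thesis
        by (simp only: smult_const_dvd_iff[OF c(1)])
    qed
    then have "to_closure ?F dvd to_closure (frob_derivation q ?F)"
      unfolding to_closure_frob_derivation
      by (rule dvd_derivation_of_irreducible_factors[OF frob_derivation_mult])
    then obtain T where T: "pcompose T f = frob_poly q * pderiv f"
        "pcompose T g = frob_poly q * pderiv g"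
      unfolding frob_derivation_separated by (rule separated_dvd_imp_pcompose[OF assms(5,6)])
    \<comment> \<open>Needed to invert the leading coefficient of T; that inverse is
      \<theta>.\<close>
    have "T \<noteq> 0"
    proof
      assume "T = 0"
      then have "pderiv f = 0" and "pderiv g = 0"
        using T frob by simp_all
      with deriv show False by simp
    qed
    then show ?R
      using T by (intro exI[of _ "smult (inverse (lead_coeff T)) T"] exI[of _ "inverse (lead_coeff T)"])
        (simp add: pcompose_smult)
  next
    assume ?R
    then obtain T \<theta> where T: "lead_coeff T = 1" "\<theta> \<noteq> 0"
        "pcompose T f = smult \<theta> (frob_poly q * pderiv f)"
        "pcompose T g = smult \<theta> (frob_poly q * pderiv g)"
      by blast
    have "T \<noteq> 0" using T(1) by auto
    \<comment> \<open>T(f) is nonzero because f is nonconstant; this yields squarefreeness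
      below.\<close>
    then have "pderiv f \<noteq> 0"
      using T(3) assms(5) pcompose_eq_0_iff[of f T] by auto
    then have deriv': "pderiv (map_poly to_ac f) \<noteq> 0"
      by (simp flip: map_poly_to_ac_pderiv add: map_poly_to_ac_eq_0_iff)
    have "?F dvd in_x [:inverse \<theta>:] * (in_x (pcompose T f) - in_y (pcompose T g))"
      using separated_dvd_pcompose by (rule dvd_mult)
    also have "\<dots> = frob_derivation q ?F"
      unfolding T(3,4) frob_derivation_separated using T(2)
      by (intro poly_eqI)
        (simp add: in_x_def coeff_in_y coeff_pCons right_diff_distrib split: nat.split
          flip: mult.assoc)
    finally have F: "to_closure ?F dvd frob_derivation q (to_closure ?F)"
      unfolding to_closure_frob_derivation[symmetric] by (rule to_closure_dvd)
    show ?L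
      unfolding component_frobenius_nonclassical_def frobenius_nonclassical_def
    proof (intro allI impI)
      fix G
      assume comp: "irreducible_component ?F G"
      then have G: "Factorial_Ring.irreducible G" "G dvd to_closure ?F"
        by (auto simp: irreducible_component_def)
      obtain H c where H: "ground_equation H G" and c: "c \<noteq> 0" "to_closure H = smult [:c:] G"
        using assms(8)[OF comp] unfolding defined_over_ground_def ground_equation_def by blast
      have "\<not> G\<^sup>2 dvd to_closure ?F"
        unfolding to_closure_diff to_closure_in_x to_closure_in_y
        using deriv' G(1) assms(6)
        by (intro separated_irreducible_factor_squarefree) (simp_all add: degree_map_poly)
      then have "G dvd frob_derivation q G"
        by (rule irreducible_dvd_derivation[OF frob_derivation_mult G _ F])
      then have dvd: "to_closure H dvd to_closure (frob_derivation q H)"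
        by (simp add: to_closure_frob_derivation c frob_derivation_smult smult_const_dvd_iff)
      \<comment> \<open>The leading coefficient of H in y therefore divides a nonzero constant,
        which makes it a unit and lets the divisibility descend to the ground field.\<close>
      have "to_closure H dvd to_closure ?F"
        using G(2) c by (simp add: smult_const_dvd_iff)
      then have "lead_coeff (to_closure H) dvd lead_coeff (to_closure ?F)"
        by (auto elim!: dvdE simp: lead_coeff_mult)
      moreover have "is_unit (lead_coeff (to_closure ?F))"
        unfolding lead_coeff_to_closure degree_separated(2)[OF assms(6)] using assms(6)
        by (auto simp: map_poly_pCons is_unit_const_poly_iff dvd_field_iff)
      ultimately have "is_unit (map_poly to_ac (lead_coeff H))"
        unfolding lead_coeff_to_closure using dvd_trans by blast
      then have "is_unit (lead_coeff H)"
        by (simp only: is_unit_map_poly_to_ac_iff)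
      then have "H dvd frob_derivation q H"
        using dvd by (rule to_closure_dvd_imp_dvd)
      moreover have "absolutely_irreducible H"
        using G(1) c by (simp add: absolutely_irreducible_def irreducible_smult_const_iff)
      ultimately show "\<exists>H. ground_equation H G \<and> absolutely_irreducible H \<and>
          H dvd in_x (frob_poly q) * partial_x H + in_y (frob_poly q) * partial_y H"
        using H unfolding frob_derivation_def by blast
    qed
  }
qed

end
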